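(* Let $$\beta_{n}(z;\lambda) = (-1)^{n-1} \frac{(\log \lambda)^{n}}{n!} \lambda^{z} \mathcal{B}_{n}(z;\lambda).$$ Let $\lambda \in (0,\infty)$, $\lambda \neq 1$, $\Lambda = 2\pi i/\log\lambda$, $\rho = |1 - \Lambda| = |1 + \Lambda|$ and $\mu = |1 - 2 \Lambda|$, so that $1 < \rho < \mu$. Let $\eta = \rho \mu^{-1}$, so $0 < \eta < 1$. Then there is a constant $c > 0$ independent of $n$ such that $$\rho^{-1} |\tanh (2\pi \operatorname{Im} z)| - c\, \eta^{n} \leq \left| \frac{\beta_{n+1}(z;\lambda) - 1}{\beta_{n}(z;\lambda) - 1}\right| \leq \rho^{-1} |\coth (2\pi \operatorname{Im} z)| + c\, \eta^{n}.$$ The estimate holds uniformly in $n$ for $z$ in compact subsets of $\mathbb{C}\setminus\mathbb{R}$.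
   Context: The Apostol-Bernoulli polynomials $\mathcal{B}_n(x;\lambda)$ ($n\ge 0$, $\lambda\in\mathbb{C}$) are defined by the power series expansion at $z=0$ $$\frac{z e^{xz}}{\lambda e^z-1} = \sum_{n=0}^\infty \mathcal{B}_n(x;\lambda)\, \frac{z^n}{n!}.$$ Here $\log$ is the principal branch of the logarithm (for $\lambda>0$, the real logarithm), and $\lambda^z = e^{z\log\lambda}$.
   Formalization: For each compact K in C\R, the constant c (depending on K) serves all z in K and every n such that β_n is nowhere 1 on K (all but finitely many n); for other n the quotient can be undefined and unbounded on K, e.g. n=1, λ=e near z=ln(e−1)+2πi. *)

theory Defs
  imports "HOL-Complex_Analysis.Complex_Analysis"
begin

(* Division of formal power series over a field cancels common powers of the variable,
   so the generating function also makes sense when l = 1, where the denominator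
   has a simple zero. *)
definition apostol_bernoulli_fps :: "complex \<Rightarrow> complex \<Rightarrow> complex fps" where
  "apostol_bernoulli_fps x l = fps_X * fps_exp x / (fps_const l * fps_exp 1 - 1)"

definition apostol_bernoulli :: "nat \<Rightarrow> complex \<Rightarrow> complex \<Rightarrow> complex" where
  "apostol_bernoulli n x l = fact n * fps_nth (apostol_bernoulli_fps x l) n"

(* The formal definition agrees with the Taylor expansion at z = 0 of the
   analytic generating function. At z = 0 the removable singularity for l = 1 is filled in. *)
lemma has_fps_expansion_apostol_bernoulli:
  "(\<lambda>z. if z = 0 then (if l = 1 then 1 else 0) else z * exp (x * z) / (l * exp z - 1))
     has_fps_expansion Abs_fps (\<lambda>n. apostol_bernoulli n x l / fact n)"
proof -
  define G where "G = fps_const l * fps_exp 1 - (1 :: complex fps)"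
  define F where "F = fps_X * fps_exp x"
  have G0: "fps_nth G 0 = l - 1" and G1: "fps_nth G 1 = l"
    by (simp_all add: G_def)
  have "G \<noteq> 0"
  proof
    assume "G = 0"
    with G0 G1 show False by simp
  qed
  have subG: "subdegree G = (if l = 1 then 1 else 0)"
    using G0 G1 by (auto intro!: subdegreeI)
  have F1: "fps_nth F 1 = 1"
    by (simp add: F_def)
  have subF: "subdegree F = 1"
    using F1 by (intro subdegreeI) (auto simp: F_def)
  have "(\<lambda>z. if z = 0 then (if l = 1 then 1 else 0) else z * exp (x * z) / (l * exp z - 1))
          has_fps_expansion F / G"
  proof (rule has_fps_expansion_divide)
    show "(\<lambda>z. z * exp (x * z)) has_fps_expansion F"
      unfolding F_def by (intro fps_expansion_intros)
    show "(\<lambda>z. l * exp z - 1) has_fps_expansion G"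
      unfolding G_def by (intro fps_expansion_intros)
    show "subdegree G \<le> subdegree F"
      using subG subF by auto
    show "G \<noteq> 0" by fact
    show "(if l = 1 then 1 else 0) = fps_nth F (subdegree G) / fps_nth G (subdegree G)"
      using F1 G1 by (auto simp: subG F_def)
  qed
  also have "F / G = Abs_fps (\<lambda>n. apostol_bernoulli n x l / fact n)"
    by (simp add: fps_eq_iff apostol_bernoulli_def apostol_bernoulli_fps_def F_def G_def)
  finally show ?thesis .
qed

(* The exponent n - 1 is taken in the integers, so that n = 0 is not truncated;
   complex powr is x powr z = exp (z * Ln x) for x \<noteq> 0. *)
definition beta_ab :: "nat \<Rightarrow> complex \<Rightarrow> complex \<Rightarrow> complex" where
  "beta_ab n z l =
     (-1) powi (int n - 1) * (Ln l ^ n / fact n) * l powr z * apostol_bernoulli n z l"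

definition coth :: "real \<Rightarrow> real" where
  "coth x = cosh x / sinh x"

end

theory Submission
  imports Defs
begin

text \<open>
  For fixed \<open>z\<close> the generating function \<open>w e\<^sup>z\<^sup>w / (l e\<^sup>w - 1)\<close> has simple poles exactly at
  \<open>p\<^sub>k = 2 \<pi> i k - ln l = - ln l (1 - k \<Lambda>)\<close>, with \<open>k\<close> ranging over the integers. By the residue
  theorem on a circle of radius \<open>r\<close> about 0 that passes between two consecutive pairs of poles,
  the \<open>n\<close>-th Taylor coefficient at 0 is minus the sum of the residues \<open>exp (z p\<^sub>k) / p\<^sub>k\<^sup>n\<close> over
  the enclosed poles, up to an error \<open>O(r\<^sup>-\<^sup>n)\<close>. The normalisation of \<open>\<beta>\<^sub>n\<close> removes the factors
  \<open>l\<^sup>-\<^sup>z\<close> and \<open>(- ln l)\<^sup>n\<close>, so that \<open>\<beta>\<^sub>n(z)\<close> is asymptotically the Fourier series with terms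
  \<open>exp (2 \<pi> i k z) / (1 - k \<Lambda>)\<^sup>n\<close>. This is \<open>beta_ab_fourier_expansion\<close>.

  The term with \<open>k = 0\<close> is the constant 1. Since \<open>\<Lambda>\<close> is purely imaginary, the terms with
  \<open>k = 1\<close> and \<open>k = -1\<close> have absolute values \<open>exp (-2 \<pi> Im z) / \<rho>\<^sup>n\<close> and \<open>exp (2 \<pi> Im z) / \<rho>\<^sup>n\<close>, and
  everything else is \<open>O(\<mu>\<^sup>-\<^sup>n)\<close>, uniformly on compact sets. The triangle inequality therefore
  confines \<open>\<rho>\<^sup>n \<bar>\<beta>\<^sub>n(z) - 1\<bar>\<close> to the interval from \<open>2 \<bar>sinh (2 \<pi> Im z)\<bar>\<close> to
  \<open>2 cosh (2 \<pi> Im z)\<close>, up to \<open>O(\<eta>\<^sup>n)\<close> (\<open>scaled_beta_ab_minus_one_bounds\<close>). Off the real axis the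
  lower endpoint is positive, hence bounded away from 0 on a compact set, and dividing the
  estimates for \<open>n + 1\<close> and \<open>n\<close> gives the quotients \<open>tanh\<close> and \<open>coth\<close> with an error \<open>O(\<eta>\<^sup>n)\<close>
  for all large \<open>n\<close> (\<open>eventually_ratio_bounds\<close>).

  Only finitely many \<open>n\<close> remain. For each of them at which \<open>\<beta>\<^sub>n\<close> avoids the value 1 on the compact
  set, the ratio is continuous there and so bounded, which a larger constant absorbs.
\<close>

section \<open>Residues of the generating function\<close>

abbreviation Lam :: "real \<Rightarrow> complex" where
  "Lam l \<equiv> 2 * of_real pi * \<i> / Ln (of_real l)"

definition pole :: "real \<Rightarrow> int \<Rightarrow> complex" where
  "pole l k = 2 * of_real pi * \<i> * of_int k - of_real (ln l)"

lemma exp_eq_inverse_iff_pole: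
  fixes l :: real
  assumes "l > 0"
  shows "of_real l * exp w = 1 \<longleftrightarrow> (\<exists>k. w = pole l k)"
proof -
  have "of_real l * exp w = 1 \<longleftrightarrow> exp w = exp (- of_real (ln l))"
    using assms by (simp add: exp_minus exp_of_real field_simps)
  also have "\<dots> \<longleftrightarrow> (\<exists>k. w = pole l k)"
    unfolding exp_eq pole_def by (simp add: algebra_simps)
  finally show ?thesis .
qed

lemma norm_pole: "norm (pole l k) = sqrt ((ln l)\<^sup>2 + (2 * pi * of_int k)\<^sup>2)"
  by (simp add: pole_def cmod_def)

lemma norm_pole_less_iff: "norm (pole l j) < norm (pole l k) \<longleftrightarrow> \<bar>j\<bar> < \<bar>k\<bar>"
proof -
  have "norm (pole l j) < norm (pole l k) \<longleftrightarrow> (real_of_int j)\<^sup>2 < (real_of_int k)\<^sup>2"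
    by (simp add: norm_pole power_mult_distrib)
  also have "\<dots> \<longleftrightarrow> \<bar>j\<bar> < \<bar>k\<bar>"
    by (metis abs_le_square_iff of_int_less_iff of_int_abs linorder_not_less)
  finally show ?thesis .
qed

lemma pole_eq:
  assumes "l > 0" "l \<noteq> 1"
  shows "pole l k = - of_real (ln l) * (1 - of_int k * Lam l)"
  using assms by (simp add: pole_def Ln_of_real field_simps)

lemma pole_nonzero:
  assumes "l > 0" "l \<noteq> 1"
  shows "pole l k \<noteq> 0"
  using assms by (auto simp: pole_def complex_eq_iff)

text \<open>
  At a pole \<open>p\<close> the denominator \<open>l e\<^sup>w - 1\<close> has derivative \<open>l e\<^sup>p = 1\<close>, so the residue is simply the
  value of the numerator.
\<close>

lemma residue_generating_function:
  assumes l: "l > 0" "l \<noteq> 1"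
  shows "residue (\<lambda>w. w * exp (z * w) / (of_real l * exp w - 1) / w ^ Suc n) (pole l k)
           = exp (z * pole l k) / pole l k ^ n"
proof -
  let ?p = "pole l k"
  have p: "of_real l * exp ?p = 1" "?p \<noteq> 0"
    using exp_eq_inverse_iff_pole[of l ?p] pole_nonzero[of l k] l by auto
  have "residue (\<lambda>w. (w * exp (z * w) / w ^ Suc n) / (of_real l * exp w - 1)) ?p
          = (?p * exp (z * ?p) / ?p ^ Suc n) / 1"
  proof (rule residue_simple_pole_deriv[where s = "ball ?p (norm ?p)"])
    show "(\<lambda>w. w * exp (z * w) / w ^ Suc n) holomorphic_on ball ?p (norm ?p)"
      by (intro holomorphic_intros) (auto simp: dist_norm)
    show "((\<lambda>w. of_real l * exp w - 1) has_field_derivative 1) (at ?p)"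
      using p by (auto intro!: derivative_eq_intros simp: mult.commute)
  qed (use p in \<open>auto intro!: holomorphic_intros\<close>)
  moreover have "(\<lambda>w. w * exp (z * w) / (of_real l * exp w - 1) / w ^ Suc n)
      = (\<lambda>w. (w * exp (z * w) / w ^ Suc n) / (of_real l * exp w - 1))"
    by (intro ext) (simp only: divide_divide_eq_left mult.commute)
  ultimately show ?thesis
    using p by simp
qed

text \<open>
  As \<open>norm (pole l k)\<close> depends only on \<open>\<bar>k\<bar>\<close> and increases with it, the poles inside the circle
  of radius \<open>r\<close> are exactly those with \<open>\<bar>k\<bar> \<le> N\<close>. The residue theorem then gives the
  estimate.
\<close>

lemma norm_taylor_coeff_plus_residues_le:
  fixes N :: nat
  assumes l: "l > 0" "l \<noteq> 1"
    and r: "norm (pole l (int N)) < r" "r < norm (pole l (int N + 1))"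
    and bound: "\<And>w. norm w = r \<Longrightarrow> norm (w * exp (z * w) / (of_real l * exp w - 1)) \<le> C"
  shows "norm (apostol_bernoulli n z (of_real l) / fact n
           + (\<Sum>k\<in>{- int N..int N}. exp (z * pole l k) / pole l k ^ n)) \<le> C / r ^ n"
proof -
  define f where "f = (\<lambda>w. w * exp (z * w) / (complex_of_real l * exp w - 1))"
  define S where "S = pole l ` {- int N..int N}"
  have "r > 0"
    using r(1) norm_ge_zero[of "pole l (int N)"] by linarith
  have "inj (pole l)"
    by (auto simp: inj_on_def pole_def)
  have "f = (\<lambda>w. if w = 0 then (if complex_of_real l = 1 then 1 else 0)
                 else w * exp (z * w) / (of_real l * exp w - 1))"
    using l by (auto simp: f_def fun_eq_iff)
  with has_fps_expansion_apostol_bernoulli[of "of_real l" z]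
  have "f has_fps_expansion Abs_fps (\<lambda>n. apostol_bernoulli n z (of_real l) / fact n)"
    by simp
  from fps_nth_fps_expansion[OF this, of n]
  have coeff: "(deriv ^^ n) f 0 / fact n = apostol_bernoulli n z (of_real l) / fact n"
    by simp
  have in_S: "w \<in> S" if w: "norm w < norm (pole l (int N + 1))" "of_real l * exp w = 1" for w
  proof -
    obtain k where "w = pole l k"
      using exp_eq_inverse_iff_pole[of l w] l w(2) by auto
    with w(1) show ?thesis
      unfolding S_def by (intro image_eqI[of _ _ k]) (auto simp: norm_pole_less_iff)
  qed
  have "C \<ge> 0"
    using bound[of "of_real r"] \<open>r > 0\<close> by (smt (verit) norm_ge_zero norm_of_real)
  have "norm ((deriv ^^ n) f 0 / fact n + (\<Sum>w\<in>S. residue (\<lambda>w. f w / w ^ Suc n) w)) \<le> C / r ^ n"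
  proof (rule fps_coeff_residues_bound[where A = "ball 0 (norm (pole l (int N + 1)))" and k = "{}"])
    show "f holomorphic_on ball 0 (norm (pole l (int N + 1))) - S"
      unfolding f_def using in_S by (intro holomorphic_intros) auto
    show "S \<subseteq> ball 0 r"
    proof
      fix w assume "w \<in> S"
      then obtain k where k: "w = pole l k" "\<bar>k\<bar> \<le> int N"
        by (auto simp: S_def)
      then have "norm w \<le> norm (pole l (int N))"
        using norm_pole_less_iff[of l "int N" k] by auto
      with r show "w \<in> ball 0 r" by simp
    qed
    show "0 \<notin> S"
      using pole_nonzero[OF l] by (metis S_def imageE)
  qed (use r \<open>r > 0\<close> \<open>C \<ge> 0\<close> bound in \<open>auto simp: S_def f_def\<close>)
  also have "(\<Sum>w\<in>S. residue (\<lambda>w. f w / w ^ Suc n) w)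
      = (\<Sum>k\<in>{- int N..int N}. exp (z * pole l k) / pole l k ^ n)"
    unfolding S_def f_def
    by (subst sum.reindex)
       (use \<open>inj (pole l)\<close> residue_generating_function[OF l] in \<open>auto simp: inj_on_def\<close>)
  finally show ?thesis
    unfolding coeff .
qed

section \<open>Fourier expansion\<close>

definition fourier_mode :: "real \<Rightarrow> nat \<Rightarrow> complex \<Rightarrow> int \<Rightarrow> complex" where
  "fourier_mode l n z k = exp (2 * of_real pi * \<i> * of_int k * z)
     / (1 - of_int k * Lam l) ^ n"

text \<open>
  Multiplying the residue at \<open>p\<^sub>k\<close> by \<open>(- ln l)\<^sup>n l\<^sup>z\<close> yields the \<open>k\<close>-th Fourier mode, because
  \<open>p\<^sub>k = - ln l (1 - k \<Lambda>)\<close>. The lemma therefore carries the residue estimate over to \<open>\<beta>\<^sub>n\<close>.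
\<close>

lemma beta_ab_minus_fourier_modes:
  assumes l: "l > 0" "l \<noteq> 1"
  shows "beta_ab n z (of_real l) - (\<Sum>k\<in>A. fourier_mode l n z k)
    = - ((- of_real (ln l)) ^ n * of_real l powr z
        * (apostol_bernoulli n z (of_real l) / fact n + (\<Sum>k\<in>A. exp (z * pole l k) / pole l k ^ n)))"
proof -
  have m: "(- of_real (ln l)) ^ n * of_real l powr z * (exp (z * pole l k) / pole l k ^ n) = fourier_mode l n z k"
    for k
  proof -
    have "of_real l powr z * exp (z * pole l k) = exp (2 * of_real pi * \<i> * of_int k * z)"
      using l by (simp add: powr_def Ln_of_real pole_def algebra_simps flip: exp_add)
    moreover have "(- of_real (ln l)) ^ n / pole l k ^ n
        = 1 / (1 - of_int k * Lam l) ^ n"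
      unfolding pole_eq[OF l] power_mult_distrib using l by simp
    moreover have "(- of_real (ln l)) ^ n * of_real l powr z * (exp (z * pole l k) / pole l k ^ n)
        = (of_real l powr z * exp (z * pole l k)) * ((- of_real (ln l)) ^ n / pole l k ^ n)"
      by (simp only: times_divide_eq_left times_divide_eq_right mult_ac)
    ultimately show ?thesis
      unfolding fourier_mode_def by simp
  qed
  have s: "(-1) powi (int n - 1) = - ((-1) ^ n :: complex)"
    by (simp add: power_int_diff)
  have "beta_ab n z (of_real l)
      = - ((- of_real (ln l)) ^ n * of_real l powr z * (apostol_bernoulli n z (of_real l) / fact n))"
    unfolding beta_ab_def s using l by (simp add: Ln_of_real power_minus[of "of_real (ln l)"])
  then show ?thesis
    by (simp only: distrib_left sum_distrib_left m minus_add_distrib diff_conv_add_uminus)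
qed


lemma compact_norm_bound:
  fixes f :: "'a :: topological_space \<Rightarrow> 'b :: real_normed_vector"
  assumes "compact K" "continuous_on K f"
  obtains C where "C \<ge> 0" "\<And>x. x \<in> K \<Longrightarrow> norm (f x) \<le> C"
proof -
  obtain C where "\<forall>y\<in>f ` K. norm y \<le> C"
    using compact_imp_bounded[OF compact_continuous_image[OF assms(2,1)]]
    by (auto simp: bounded_iff)
  then show ?thesis
    by (intro that[of "max C 0"]) (auto intro: order.trans[OF _ max.cobounded1])
qed

text \<open>
  The error is of the order of the first omitted pair of modes. A circle enclosing only the
  poles with \<open>\<bar>k\<bar> \<le> N\<close> would give a slightly worse rate, so the proof encloses one further pair,
  for which the remaining integral decays strictly faster, and then moves that pair to the
  error term.
\<close>

lemma beta_ab_fourier_expansion: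
  fixes N :: nat
  assumes l: "l > 0" "l \<noteq> 1" and K: "compact K"
  obtains C where "C \<ge> 0" "\<And>n z. z \<in> K \<Longrightarrow>
    norm (beta_ab n z (of_real l) - (\<Sum>k\<in>{- int N..int N}. fourier_mode l n z k))
      \<le> C / norm (1 - of_int (int N + 1) * Lam l) ^ n"
proof -
  define m where "m = int N + 1"
  define q where "q = norm (1 - of_int m * Lam l)"
  define r where "r = (norm (pole l m) + norm (pole l (m + 1))) / 2"
  have "norm (pole l m) < norm (pole l (m + 1))"
    by (simp add: norm_pole_less_iff m_def)
  then have r: "norm (pole l m) < r" "r < norm (pole l (m + 1))"
    by (simp_all add: r_def)
  then have "r > 0"
    using norm_ge_zero[of "pole l m"] by linarith
  have q: "norm (pole l k) = \<bar>ln l\<bar> * norm (1 - of_int k * Lam l)" for k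
    unfolding pole_eq[OF l] by (simp add: norm_mult)
  have "q > 0"
    using q[of m] pole_nonzero[OF l, of m] by (auto simp: q_def)
  have not_pole: "of_real l * exp w - 1 \<noteq> 0" if "norm w = r" for w :: complex
  proof
    assume "of_real l * exp w - 1 = 0"
    then obtain k where "w = pole l k"
      using exp_eq_inverse_iff_pole[of l w] l by auto
    with that r have "\<bar>m\<bar> < \<bar>k\<bar>" "\<bar>k\<bar> < \<bar>m + 1\<bar>"
      using norm_pole_less_iff by metis+
    then show False by (simp add: m_def)
  qed
  obtain C1 where C1: "C1 \<ge> 0" "\<And>x. x \<in> K \<times> sphere 0 r \<Longrightarrow>
      norm (snd x * exp (fst x * snd x) / (of_real l * exp (snd x) - 1)) \<le> C1"
    using not_pole
    by (rule_tac compact_norm_bound[of "K \<times> sphere 0 r"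
          "\<lambda>x. snd x * exp (fst x * snd x) / (of_real l * exp (snd x) - 1)"])
       (auto intro!: continuous_intros compact_Times K)
  obtain C2 where C2: "C2 \<ge> 0" "\<And>z. z \<in> K \<Longrightarrow> norm (exp (z * of_real (ln l))) \<le> C2"
    by (rule compact_norm_bound[OF K, of "\<lambda>z. exp (z * of_real (ln l))"])
       (auto intro!: continuous_intros)
  obtain C3 where C3: "C3 \<ge> 0" "\<And>z. z \<in> K \<Longrightarrow> norm (exp (2 * of_real pi * \<i> * of_int m * z)) \<le> C3"
    by (rule compact_norm_bound[OF K, of "\<lambda>z. exp (2 * of_real pi * \<i> * of_int m * z)"])
       (auto intro!: continuous_intros)
  obtain C4 where C4: "C4 \<ge> 0" "\<And>z. z \<in> K \<Longrightarrow> norm (exp (2 * of_real pi * \<i> * of_int (- m) * z)) \<le> C4"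
    by (rule compact_norm_bound[OF K, of "\<lambda>z. exp (2 * of_real pi * \<i> * of_int (- m) * z)"])
       (auto intro!: continuous_intros)
  have q_minus: "norm (1 - of_int (- m) * Lam l) = q"
    using q[of m] q[of "- m"] l unfolding q_def by (simp add: norm_pole)
  show ?thesis
  proof
    show "C2 * C1 + C3 + C4 \<ge> 0"
      using C1 C2 C3 C4 by simp
  next
    fix n z assume z: "z \<in> K"
    define S where "S = apostol_bernoulli n z (of_real l) / fact n
      + (\<Sum>k\<in>{- m..m}. exp (z * pole l k) / pole l k ^ n)"
    have "norm S \<le> C1 / r ^ n"
      using norm_taylor_coeff_plus_residues_le[OF l, of "nat m" r z C1 n] r C1(2)[of "(z, _)"] z
      by (auto simp: S_def m_def)
    have "norm (beta_ab n z (of_real l) - (\<Sum>k\<in>{- m..m}. fourier_mode l n z k))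
        = \<bar>ln l\<bar> ^ n * norm (exp (z * of_real (ln l))) * norm S"
      unfolding beta_ab_minus_fourier_modes[OF l] S_def
      using l by (simp add: norm_mult norm_power powr_def Ln_of_real)
    also have "\<dots> \<le> \<bar>ln l\<bar> ^ n * C2 * (C1 / r ^ n)"
      using \<open>norm S \<le> C1 / r ^ n\<close> C2 z by (intro mult_mono) auto
    also have "\<dots> = C2 * C1 * (\<bar>ln l\<bar> / r) ^ n"
      by (simp add: power_divide)
    also have "\<dots> \<le> C2 * C1 * (1 / q) ^ n"
    proof (intro mult_left_mono power_mono)
      show "\<bar>ln l\<bar> / r \<le> 1 / q"
        using r(1) q[of m] \<open>r > 0\<close> \<open>q > 0\<close> by (simp add: q_def field_simps)
    qed (use C1 C2 \<open>r > 0\<close> in auto)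
    finally have 1: "norm (beta_ab n z (of_real l) - (\<Sum>k\<in>{- m..m}. fourier_mode l n z k)) \<le> C2 * C1 / q ^ n"
      by (simp add: power_divide)
    have 2: "norm (fourier_mode l n z m) \<le> C3 / q ^ n"
      using C3(2)[OF z] \<open>q > 0\<close> unfolding fourier_mode_def norm_divide norm_power q_def
      by (intro divide_right_mono) auto
    have 3: "norm (fourier_mode l n z (- m)) \<le> C4 / q ^ n"
      using C4(2)[OF z] \<open>q > 0\<close> unfolding fourier_mode_def norm_divide norm_power q_minus
      by (intro divide_right_mono) auto
    have "{- m..m} = insert m (insert (- m) {- int N..int N})"
      by (auto simp: m_def)
    then have "(\<Sum>k\<in>{- m..m}. fourier_mode l n z k)
        = fourier_mode l n z m + fourier_mode l n z (- m) + (\<Sum>k\<in>{- int N..int N}. fourier_mode l n z k)"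
      by (simp add: m_def)
    then have "beta_ab n z (of_real l) - (\<Sum>k\<in>{- int N..int N}. fourier_mode l n z k)
        = (beta_ab n z (of_real l) - (\<Sum>k\<in>{- m..m}. fourier_mode l n z k)) + fourier_mode l n z m + fourier_mode l n z (- m)"
      by (simp add: algebra_simps)
    also have "norm \<dots> \<le> C2 * C1 / q ^ n + C3 / q ^ n + C4 / q ^ n"
      using 1 2 3 by (intro norm_triangle_mono)
    finally show "norm (beta_ab n z (of_real l) - (\<Sum>k\<in>{- int N..int N}. fourier_mode l n z k))
        \<le> (C2 * C1 + C3 + C4) / norm (1 - of_int (int N + 1) * Lam l) ^ n"
      by (simp add: q_def m_def add_divide_distrib)
  qed
qed

section \<open>Ratios of consecutive terms\<close>

lemma norm_one_minus_Lam:
  assumes "l > 0" "l \<noteq> 1"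
  shows "norm (1 - of_real t * Lam l) = sqrt (1 + (t * (2 * pi / ln l))\<^sup>2)"
  using assms by (simp add: cmod_def Ln_of_real Re_divide Im_divide power2_eq_square)

text \<open>
  With \<open>N = 1\<close> the expansion reads \<open>\<beta>\<^sub>n - 1 = a + b + e\<close>, where \<open>\<rho>\<^sup>n \<bar>a\<bar>\<close> and \<open>\<rho>\<^sup>n \<bar>b\<bar>\<close> are
  \<open>exp (-2 \<pi> Im z)\<close> and \<open>exp (2 \<pi> Im z)\<close>. The sum of these two numbers is \<open>2 cosh\<close>
  and their distance is \<open>2 \<bar>sinh\<bar>\<close>, which turns the two triangle inequalities into the bounds.
\<close>

lemma scaled_beta_ab_minus_one_bounds:
  assumes l: "l > 0" "l \<noteq> 1" and K: "compact K"
  defines "\<rho> \<equiv> norm (1 - Lam l)" and "\<mu> \<equiv> norm (1 - 2 * Lam l)"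
  obtains C where "C \<ge> 0" "\<And>n z. z \<in> K \<Longrightarrow>
      2 * \<bar>sinh (2 * pi * Im z)\<bar> - C * (\<rho> / \<mu>) ^ n
        \<le> \<rho> ^ n * norm (beta_ab n z (of_real l) - 1)"
    "\<And>n z. z \<in> K \<Longrightarrow> \<rho> ^ n * norm (beta_ab n z (of_real l) - 1)
        \<le> 2 * cosh (2 * pi * Im z) + C * (\<rho> / \<mu>) ^ n"
proof -
  have "\<rho> > 0"
    using norm_one_minus_Lam[OF l, of 1] by (simp add: \<rho>_def add_pos_nonneg)
  have \<rho>': "norm (1 + Lam l) = \<rho>"
    using norm_one_minus_Lam[OF l, of 1] norm_one_minus_Lam[OF l, of "-1"] by (simp add: \<rho>_def)
  obtain C where C: "C \<ge> 0" "\<And>n z. z \<in> K \<Longrightarrow>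
    norm (beta_ab n z (of_real l) - (\<Sum>k\<in>{- int 1..int 1}. fourier_mode l n z k))
      \<le> C / norm (1 - of_int (int 1 + 1) * Lam l) ^ n"
    using beta_ab_fourier_expansion[OF l K, where N = 1] by blast
  show ?thesis
  proof
    show "C \<ge> 0" by fact
  next
    fix n z assume z: "z \<in> K"
    define a where "a = fourier_mode l n z 1"
    define b where "b = fourier_mode l n z (- 1)"
    define e where "e = beta_ab n z (of_real l) - 1 - a - b"
    have "{- int 1..int 1} = {-1, 0, 1}" by auto
    then have "(\<Sum>k\<in>{- int 1..int 1}. fourier_mode l n z k) = 1 + a + b"
      by (simp add: a_def b_def fourier_mode_def)
    with C(2)[OF z, of n] have "norm e \<le> C / \<mu> ^ n"
      by (simp add: e_def \<mu>_def algebra_simps)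
    then have "\<rho> ^ n * norm e \<le> \<rho> ^ n * (C / \<mu> ^ n)"
      using \<open>\<rho> > 0\<close> by (intro mult_left_mono) auto
    then have e: "\<rho> ^ n * norm e \<le> C * (\<rho> / \<mu>) ^ n"
      by (simp add: power_divide mult.commute)
    have "norm a = exp (- (2 * pi * Im z)) / \<rho> ^ n"
      by (simp add: a_def fourier_mode_def norm_divide norm_power \<rho>_def)
    then have a: "\<rho> ^ n * norm a = exp (- (2 * pi * Im z))"
      using \<open>\<rho> > 0\<close> by simp
    have "norm b = exp (2 * pi * Im z) / \<rho> ^ n"
      by (simp add: b_def fourier_mode_def norm_divide norm_power \<rho>')
    then have b: "\<rho> ^ n * norm b = exp (2 * pi * Im z)"
      using \<open>\<rho> > 0\<close> by simp
    have eq: "beta_ab n z (of_real l) - 1 = a + b + e"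
      by (simp add: e_def)
    have "norm (a + b + e) \<le> norm a + norm b + norm e"
      by (intro norm_triangle_mono) auto
    then have "\<rho> ^ n * norm (a + b + e) \<le> \<rho> ^ n * (norm a + norm b + norm e)"
      using \<open>\<rho> > 0\<close> by (intro mult_left_mono) auto
    with a b e show "\<rho> ^ n * norm (beta_ab n z (of_real l) - 1)
        \<le> 2 * cosh (2 * pi * Im z) + C * (\<rho> / \<mu>) ^ n"
      unfolding eq by (simp add: cosh_def distrib_left)
    have "norm (a + b + e) \<ge> norm a - norm b - norm e" "norm (a + b + e) \<ge> norm b - norm a - norm e"
      by norm+
    then have "\<rho> ^ n * (norm a - norm b - norm e) \<le> \<rho> ^ n * norm (a + b + e)"
        "\<rho> ^ n * (norm b - norm a - norm e) \<le> \<rho> ^ n * norm (a + b + e)"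
      using \<open>\<rho> > 0\<close> by (auto intro!: mult_left_mono)
    with a b e show "2 * \<bar>sinh (2 * pi * Im z)\<bar> - C * (\<rho> / \<mu>) ^ n
        \<le> \<rho> ^ n * norm (beta_ab n z (of_real l) - 1)"
      unfolding eq by (simp add: sinh_def right_diff_distrib abs_if)
  qed
qed

text \<open>
  The condition \<open>e \<le> B / 2\<close> keeps the denominator \<open>y\<close> at least \<open>B / 2\<close>. This makes the
  effect of the perturbation linear in \<open>e\<close>, with the same explicit factor on both sides.
\<close>

lemma perturbed_ratio_bounds:
  fixes A B s e x y :: real
  assumes AB: "0 < B" "B \<le> A" and e: "0 \<le> e" "e \<le> B / 2" and s: "0 \<le> s" "s \<le> 1"
    and x: "0 \<le> x" "s * B - e \<le> x" "x \<le> s * A + e"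
    and y: "B - e \<le> y" "y \<le> A + e"
  shows "s * (B / A) - 4 * e * A / B\<^sup>2 \<le> x / y" "x / y \<le> s * (A / B) + 4 * e * A / B\<^sup>2"
proof -
  have pos: "B - e > 0" "A > 0" "y > 0" "A + e > 0" using AB e y by auto
  have sAB: "B + s * A \<le> 2 * A" "s * B + A \<le> 4 * A"
    using AB mult_right_mono[OF s(2), of A] mult_right_mono[OF s(2), of B] by linarith+
  have "x / y \<le> (s * A + e) / (B - e)"
    using x y pos s AB by (intro frac_le) auto
  also have "\<dots> = s * (A / B) + e * (B + s * A) / (B * (B - e))"
    using AB pos by (simp add: field_simps)
  also have "e * (B + s * A) / (B * (B - e)) \<le> e * (2 * A) / (B * (B / 2))"
    using AB sAB e pos s by (intro frac_le mult_left_mono mult_pos_pos) simp_all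
  finally show "x / y \<le> s * (A / B) + 4 * e * A / B\<^sup>2"
    by (simp add: power2_eq_square)
  have "s * (B / A) - e * (s * B + A) / (A * (A + e)) = (s * B - e) / (A + e)"
    using AB pos e by (simp add: divide_simps) (simp add: algebra_simps)
  also have "\<dots> \<le> x / (A + e)"
    using x pos by (intro divide_right_mono) auto
  also have "\<dots> \<le> x / y"
    using x y pos by (intro divide_left_mono) auto
  finally have 1: "s * (B / A) - e * (s * B + A) / (A * (A + e)) \<le> x / y" .
  have "e * (s * B + A) / (A * (A + e)) \<le> e * (4 * A) / (B * B)"
    using AB sAB e pos s
    by (intro frac_le mult_left_mono mult_pos_pos mult_mono mult_nonneg_nonneg) simp_all
  with 1 show "s * (B / A) - 4 * e * A / B\<^sup>2 \<le> x / y"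
    by (simp add: power2_eq_square)
qed

text \<open>
  For \<open>l \<noteq> 1\<close> the series \<open>l e\<^sup>w - 1\<close> is invertible, so each coefficient of the generating function
  is a polynomial in \<open>z\<close>.
\<close>

lemma continuous_on_beta_ab:
  assumes "l > 0" "l \<noteq> 1"
  shows "continuous_on X (\<lambda>z. beta_ab n z (of_real l))"
proof -
  define G where "G = fps_const (of_real l) * fps_exp 1 - (1 :: complex fps)"
  have "fps_nth G 0 \<noteq> 0"
    using assms by (simp add: G_def)
  then have "apostol_bernoulli n z (of_real l)
      = fact n * (\<Sum>i=0..n. fps_nth (fps_X * fps_exp z) i * fps_nth (inverse G) (n - i))" for z
    unfolding apostol_bernoulli_def apostol_bernoulli_fps_def G_def[symmetric]
    using fps_mult_nth[of "fps_X * fps_exp z" "inverse G" n] by (simp only: fps_divide_unit not_False_eq_True)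
  moreover have "continuous_on X (\<lambda>z :: complex. fps_nth (fps_X * fps_exp z) i)" for i
    by (cases i) (auto intro!: continuous_intros)
  ultimately show ?thesis
    using assms unfolding beta_ab_def by (auto intro!: continuous_intros simp: powr_def)
qed

lemma ratio_bounded_if_beta_ab_ne_one:
  assumes l: "l > 0" "l \<noteq> 1" and K: "compact K"
    and ne: "\<forall>z\<in>K. beta_ab n z (of_real l) \<noteq> 1"
  obtains D where "D \<ge> 0" "\<And>z. z \<in> K \<Longrightarrow>
    norm ((beta_ab (n + 1) z (of_real l) - 1) / (beta_ab n z (of_real l) - 1)) \<le> D"
proof (rule compact_norm_bound[OF K])
  show "continuous_on K (\<lambda>z. (beta_ab (n + 1) z (of_real l) - 1) / (beta_ab n z (of_real l) - 1))"
    using ne by (intro continuous_intros continuous_on_beta_ab[OF l]) auto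
qed (use that in blast)

text \<open>
  The previous estimates apply as soon as the error \<open>C \<eta>\<^sup>n\<close> is at most half of
  \<open>2 \<bar>sinh (2 \<pi> Im z)\<bar>\<close>, for all \<open>z\<close> in \<open>K\<close> at once. Compactness gives such an index because
  \<open>1 / \<bar>sinh (2 \<pi> Im z)\<bar>\<close> is continuous on \<open>K\<close>, and beyond it \<open>\<beta>\<^sub>n\<close> cannot take the value 1.
\<close>

lemma eventually_ratio_bounds:
  assumes l: "l > 0" "l \<noteq> 1" and K: "compact K" "K \<inter> \<real> = {}"
  defines "\<rho> \<equiv> norm (1 - Lam l)" and "\<mu> \<equiv> norm (1 - 2 * Lam l)"
  assumes \<rho>: "1 < \<rho>" "\<rho> < \<mu>"
  obtains E N where "E \<ge> 0"
    "\<And>n z. n \<ge> N \<Longrightarrow> z \<in> K \<Longrightarrow> beta_ab n z (of_real l) \<noteq> 1"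
    "\<And>n z. n \<ge> N \<Longrightarrow> z \<in> K \<Longrightarrow> inverse \<rho> * \<bar>tanh (2 * pi * Im z)\<bar> - E * (\<rho> / \<mu>) ^ n
       \<le> norm ((beta_ab (n + 1) z (of_real l) - 1) / (beta_ab n z (of_real l) - 1))"
    "\<And>n z. n \<ge> N \<Longrightarrow> z \<in> K \<Longrightarrow>
       norm ((beta_ab (n + 1) z (of_real l) - 1) / (beta_ab n z (of_real l) - 1))
       \<le> inverse \<rho> * \<bar>coth (2 * pi * Im z)\<bar> + E * (\<rho> / \<mu>) ^ n"
proof -
  define \<eta> where "\<eta> = \<rho> / \<mu>"
  define A where "A z = 2 * cosh (2 * pi * Im z)" for z
  define B where "B z = 2 * \<bar>sinh (2 * pi * Im z)\<bar>" for z
  have \<eta>: "0 < \<eta>" "\<eta> < 1"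
    using \<rho> by (auto simp: \<eta>_def)
  obtain C where C: "C \<ge> 0" "\<And>n z. z \<in> K \<Longrightarrow>
      B z - C * \<eta> ^ n \<le> \<rho> ^ n * norm (beta_ab n z (of_real l) - 1)"
    "\<And>n z. z \<in> K \<Longrightarrow> \<rho> ^ n * norm (beta_ab n z (of_real l) - 1) \<le> A z + C * \<eta> ^ n"
    using scaled_beta_ab_minus_one_bounds[OF l K(1)]
    unfolding \<rho>_def[symmetric] \<mu>_def[symmetric] \<eta>_def[symmetric] A_def B_def by blast
  have B_pos: "B z > 0" if "z \<in> K" for z
    using that K(2) by (auto simp: B_def complex_is_Real_iff)
  have B_le_A: "B z \<le> A z" for z
    using sinh_less_cosh_real[of "2 * pi * Im z"] sinh_less_cosh_real[of "- (2 * pi * Im z)"]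
    by (auto simp: A_def B_def abs_if)
  obtain M where M: "M \<ge> 0" "\<And>z. z \<in> K \<Longrightarrow> norm (2 / B z) \<le> M"
  proof (rule compact_norm_bound[OF K(1)])
    show "continuous_on K (\<lambda>z. 2 / B z)"
      using B_pos unfolding B_def by (intro continuous_intros) force
  qed blast
  obtain M' where M': "M' \<ge> 0" "\<And>z. z \<in> K \<Longrightarrow> norm (4 * A z / (B z)\<^sup>2) \<le> M'"
  proof (rule compact_norm_bound[OF K(1)])
    show "continuous_on K (\<lambda>z. 4 * A z / (B z)\<^sup>2)"
      using B_pos unfolding B_def A_def by (intro continuous_intros) force
  qed blast
  have "(\<lambda>n. M * C * \<eta> ^ n) \<longlonglongrightarrow> M * C * 0"
    using \<eta> by (intro tendsto_intros LIMSEQ_power_zero) auto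
  then have "\<forall>\<^sub>F n in sequentially. M * C * \<eta> ^ n < 1"
    by (rule order_tendstoD) simp
  then obtain N where N: "\<And>n. n \<ge> N \<Longrightarrow> M * C * \<eta> ^ n < 1"
    by (auto simp: eventually_sequentially)
  have small: "C * \<eta> ^ n \<le> B z / 2" if "n \<ge> N" "z \<in> K" for n z
  proof -
    have "2 / B z * (C * \<eta> ^ n) \<le> M * (C * \<eta> ^ n)"
      using M(2)[OF that(2)] B_pos[OF that(2)] C(1) \<eta> by (intro mult_right_mono) auto
    also have "\<dots> \<le> 1"
      using N[OF that(1)] by simp
    finally show ?thesis
      using B_pos[OF that(2)] by (simp add: field_simps)
  qed
  have ne: "beta_ab n z (of_real l) \<noteq> 1" if "n \<ge> N" "z \<in> K" for n z
    using C(2)[OF that(2), of n] small[OF that] B_pos[OF that(2)] by auto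
  have main: "inverse \<rho> * (B z / A z) - M' * C * \<eta> ^ n
        \<le> norm ((beta_ab (n + 1) z (of_real l) - 1) / (beta_ab n z (of_real l) - 1))"
      "norm ((beta_ab (n + 1) z (of_real l) - 1) / (beta_ab n z (of_real l) - 1))
        \<le> inverse \<rho> * (A z / B z) + M' * C * \<eta> ^ n" if n: "n \<ge> N" and z: "z \<in> K" for n z
  proof -
    define x where "x = \<rho> ^ n * norm (beta_ab (n + 1) z (of_real l) - 1)"
    define y where "y = \<rho> ^ n * norm (beta_ab n z (of_real l) - 1)"
    have ratio: "norm ((beta_ab (n + 1) z (of_real l) - 1) / (beta_ab n z (of_real l) - 1)) = x / y"
      using \<rho> by (simp add: x_def y_def norm_divide)
    have x_eq: "x = inverse \<rho> * (\<rho> ^ (n + 1) * norm (beta_ab (n + 1) z (of_real l) - 1))"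
      using \<rho> by (simp add: x_def)
    have "inverse \<rho> * (C * \<eta> ^ (n + 1)) \<le> 1 * (C * \<eta> ^ n)"
      using \<rho> \<eta> C(1) by (intro mult_mono mult_left_mono power_decreasing) (auto simp: inverse_le_1_iff)
    moreover have "inverse \<rho> * (B z - C * \<eta> ^ (n + 1)) \<le> x" "x \<le> inverse \<rho> * (A z + C * \<eta> ^ (n + 1))"
      unfolding x_eq using C(2,3)[OF z, of "n + 1"] \<rho> by (auto intro!: mult_left_mono)
    ultimately have x: "inverse \<rho> * B z - C * \<eta> ^ n \<le> x" "x \<le> inverse \<rho> * A z + C * \<eta> ^ n"
      by (simp_all add: ring_distribs)
    have y: "B z - C * \<eta> ^ n \<le> y" "y \<le> A z + C * \<eta> ^ n"
      using C(2,3)[OF z, of n] by (auto simp: y_def)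
    have s: "0 \<le> inverse \<rho>" "inverse \<rho> \<le> 1"
      using \<rho> by (auto simp: inverse_le_1_iff)
    have e: "0 \<le> C * \<eta> ^ n" and x0: "0 \<le> x"
      using C(1) \<eta> \<rho> by (auto simp: x_def)
    note bounds = perturbed_ratio_bounds[OF B_pos[OF z] B_le_A e small[OF n z] s x0 x y]
    have "4 * A z / (B z)\<^sup>2 * (C * \<eta> ^ n) \<le> M' * (C * \<eta> ^ n)"
      using abs_le_D1[OF M'(2)[OF z, unfolded real_norm_def]] e by (intro mult_right_mono)
    then have "4 * (C * \<eta> ^ n) * A z / (B z)\<^sup>2 \<le> M' * C * \<eta> ^ n"
      by (simp add: mult_ac)
    with bounds show "inverse \<rho> * (B z / A z) - M' * C * \<eta> ^ n
        \<le> norm ((beta_ab (n + 1) z (of_real l) - 1) / (beta_ab n z (of_real l) - 1))"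
      "norm ((beta_ab (n + 1) z (of_real l) - 1) / (beta_ab n z (of_real l) - 1))
        \<le> inverse \<rho> * (A z / B z) + M' * C * \<eta> ^ n"
      unfolding ratio by linarith+
  qed
  have tanh: "\<bar>tanh (2 * pi * Im z)\<bar> = B z / A z" and coth: "\<bar>coth (2 * pi * Im z)\<bar> = A z / B z" for z
    by (simp_all add: tanh_def coth_def A_def B_def abs_divide)
  show ?thesis
    by (rule that[of "M' * C" N, unfolded tanh coth, folded \<eta>_def])
       (use M'(1) C(1) ne main in auto)
qed

theorem proposition9:
  fixes l \<rho> \<mu> \<eta> :: real and \<Lambda> :: complex
  assumes "l \<in> {0<..}" and "l \<noteq> 1"
    and "\<Lambda> = 2 * of_real pi * \<i> / Ln (of_real l)"
    and "\<rho> = norm (1 - \<Lambda>)"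
    and "\<mu> = norm (1 - 2 * \<Lambda>)"
    and "\<eta> = \<rho> * inverse \<mu>"
  shows "norm (1 + \<Lambda>) = \<rho> \<and> 1 < \<rho> \<and> \<rho> < \<mu> \<and> 0 < \<eta> \<and> \<eta> < 1 \<and>
    (\<forall>K. compact K \<and> K \<subseteq> UNIV - \<real> \<longrightarrow>
       (\<forall>\<^sub>F n in sequentially. \<forall>z\<in>K. beta_ab n z (of_real l) \<noteq> 1) \<and>
       (\<exists>c>0. \<forall>n. (\<forall>z\<in>K. beta_ab n z (of_real l) \<noteq> 1) \<longrightarrow>
          (\<forall>z\<in>K.
             inverse \<rho> * \<bar>tanh (2 * pi * Im z)\<bar> - c * \<eta> ^ n
               \<le> norm ((beta_ab (n + 1) z (of_real l) - 1) / (beta_ab n z (of_real l) - 1)) \<and>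
             norm ((beta_ab (n + 1) z (of_real l) - 1) / (beta_ab n z (of_real l) - 1))
               \<le> inverse \<rho> * \<bar>coth (2 * pi * Im z)\<bar> + c * \<eta> ^ n)))"
proof -
  have l: "l > 0" "l \<noteq> 1"
    using assms by auto
  have \<rho>_eq: "\<rho> = norm (1 - Lam l)" and \<mu>_eq: "\<mu> = norm (1 - 2 * Lam l)" and \<eta>_eq: "\<eta> = \<rho> / \<mu>"
    using assms by (auto simp: divide_inverse)
  define t where "t = (2 * pi / ln l)\<^sup>2"
  have "t > 0"
    using l by (simp add: t_def)
  have norms: "\<rho> = sqrt (1 + t)" "\<mu> = sqrt (1 + 4 * t)" "norm (1 + \<Lambda>) = sqrt (1 + t)"
    using norm_one_minus_Lam[OF l, of 1] norm_one_minus_Lam[OF l, of 2] norm_one_minus_Lam[OF l, of "-1"]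
    by (simp_all add: \<rho>_eq \<mu>_eq assms(3) t_def power_mult_distrib power_divide)
  have \<rho>: "1 < \<rho>" "\<rho> < \<mu>"
    using \<open>t > 0\<close> by (simp_all add: norms)
  have \<eta>: "0 < \<eta>" "\<eta> < 1"
    using \<rho> by (auto simp: \<eta>_eq)
  let ?Q = "\<lambda>n z. norm ((beta_ab (n + 1) z (of_real l) - 1) / (beta_ab n z (of_real l) - 1))"
  have "(\<forall>\<^sub>F n in sequentially. \<forall>z\<in>K. beta_ab n z (of_real l) \<noteq> 1) \<and>
    (\<exists>c>0. \<forall>n. (\<forall>z\<in>K. beta_ab n z (of_real l) \<noteq> 1) \<longrightarrow>
      (\<forall>z\<in>K. inverse \<rho> * \<bar>tanh (2 * pi * Im z)\<bar> - c * \<eta> ^ n \<le> ?Q n z \<and>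
              ?Q n z \<le> inverse \<rho> * \<bar>coth (2 * pi * Im z)\<bar> + c * \<eta> ^ n))"
    if K: "compact K" "K \<inter> \<real> = {}" for K
  proof -
    obtain E N where E: "E \<ge> 0" and ne: "\<And>n z. n \<ge> N \<Longrightarrow> z \<in> K \<Longrightarrow> beta_ab n z (of_real l) \<noteq> 1"
      and large: "\<And>n z. n \<ge> N \<Longrightarrow> z \<in> K \<Longrightarrow>
          inverse \<rho> * \<bar>tanh (2 * pi * Im z)\<bar> - E * \<eta> ^ n \<le> ?Q n z"
        "\<And>n z. n \<ge> N \<Longrightarrow> z \<in> K \<Longrightarrow>
          ?Q n z \<le> inverse \<rho> * \<bar>coth (2 * pi * Im z)\<bar> + E * \<eta> ^ n"
      using eventually_ratio_bounds[OF l K] \<rho>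
      unfolding \<rho>_eq[symmetric] \<mu>_eq[symmetric] \<eta>_eq[symmetric] by blast
    have "\<exists>D\<ge>0. (\<forall>z\<in>K. beta_ab n z (of_real l) \<noteq> 1) \<longrightarrow> (\<forall>z\<in>K. ?Q n z \<le> D)" for n
      using ratio_bounded_if_beta_ab_ne_one[OF l K(1), of n] by (metis order_refl)
    then obtain D where D: "\<And>n. D n \<ge> 0"
      "\<And>n z. \<forall>z\<in>K. beta_ab n z (of_real l) \<noteq> 1 \<Longrightarrow> z \<in> K \<Longrightarrow> ?Q n z \<le> D n"
      by metis
    \<comment> \<open>The summands give \<open>c \<eta>\<^sup>n \<ge> D n + 1\<close> for \<open>n < N\<close>. There \<open>D n\<close> serves the upper bound, and the extra 1 makes the lower bound nonpositive.\<close>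
    define c where "c = E + 1 + (\<Sum>n<N. (D n + 1) / \<eta> ^ n)"
    have sum0: "(\<Sum>n<N. (D n + 1) / \<eta> ^ n) \<ge> 0"
      using D(1) \<eta> by (intro sum_nonneg) (auto intro!: divide_nonneg_pos add_nonneg_nonneg)
    have "inverse \<rho> * \<bar>tanh (2 * pi * Im z)\<bar> - c * \<eta> ^ n \<le> ?Q n z \<and>
          ?Q n z \<le> inverse \<rho> * \<bar>coth (2 * pi * Im z)\<bar> + c * \<eta> ^ n"
      if n: "\<forall>z\<in>K. beta_ab n z (of_real l) \<noteq> 1" and z: "z \<in> K" for n z
    proof (cases "n \<ge> N")
      case True
      have "E * \<eta> ^ n \<le> c * \<eta> ^ n"
        using sum0 \<eta> by (intro mult_right_mono) (auto simp: c_def)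
      with large[OF True z] show ?thesis by linarith
    next
      case False
      have "(D n + 1) / \<eta> ^ n \<le> (\<Sum>n<N. (D n + 1) / \<eta> ^ n)"
        using False D(1) \<eta> by (intro member_le_sum) (auto intro!: divide_nonneg_pos add_nonneg_nonneg)
      then have "(D n + 1) / \<eta> ^ n \<le> c"
        using E by (simp add: c_def)
      then have c: "D n + 1 \<le> c * \<eta> ^ n"
        using \<eta> by (simp add: field_simps)
      have "inverse \<rho> * \<bar>tanh (2 * pi * Im z)\<bar> \<le> 1 * 1"
        using \<rho> tanh_real_lt_1[of "2 * pi * Im z"] tanh_real_gt_neg1[of "2 * pi * Im z"]
        by (intro mult_mono) (auto simp: inverse_le_1_iff)
      moreover have "0 \<le> inverse \<rho> * \<bar>coth (2 * pi * Im z)\<bar>"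
        using \<rho> by simp
      moreover have "0 \<le> ?Q n z" by simp
      ultimately show ?thesis
        using c D(1)[of n] D(2)[OF n z] by linarith
    qed
    moreover have "c > 0"
      using sum0 E by (simp add: c_def)
    moreover have "\<forall>\<^sub>F n in sequentially. \<forall>z\<in>K. beta_ab n z (of_real l) \<noteq> 1"
      using ne by (auto simp: eventually_sequentially)
    ultimately show ?thesis by blast
  qed
  moreover have "K \<inter> \<real> = {}" if "K \<subseteq> UNIV - \<real>" for K :: "complex set"
    using that by blast
  ultimately show ?thesis
    using norms \<rho> \<eta> by auto
qed

end
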